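(* Let $\lambda,\mu\in\mathcal P_n$. Then $\lambda$ contains $\mu$ if and only if the difference $$\frac{p_\lambda(x+\mathbf 1)}{p_\lambda(\mathbf 1)}-\frac{p_\mu(x+\mathbf 1)}{p_\mu(\mathbf 1)}$$ is power sum positive, when expressed in the basis $\{p_{\nu'}:\nu\in\mathcal P_n\}$.
   Context: Fix the number of variables $n\geqslant1$; $x=(x_1,\dots,x_n)$ and $\mathbf 1=(1,\dots,1)$ ($n$ ones). $\mathcal P_n$ is the set of partitions of length at most $n$, i.e. $n$-tuples of integers $\lambda_1\geqslant\dots\geqslant\lambda_n\geqslant0$. "$\lambda$ contains $\mu$" means $\lambda_i\geqslant\mu_i$ for all $i$, and $\nu'$ denotes the conjugate (transpose) of a partition $\nu$. Power sums: for $1\leqslant k\leqslant n$, $p_k(x)=\sum_{i=1}^n x_i^k$, and $p_\lambda=p_{\lambda_1}\cdots p_{\lambda_l}$, where $l=\ell(\lambda)$ is the number of nonzero parts of $\lambda$; one sets $p_{\mathbf 0}=n$ for the zero partition $\mathbf 0=(0,\dots,0)$. The power sums $p_1,\dots,p_n$ are algebraically independent, and $\{p_{\nu'}:\nu\in\mathcal P_n\}$ is a $\mathbb Q$-basis of the ring of symmetric polynomials $\mathbb Q[x_1,\dots,x_n]^{S_n}$. Power sum positive means that all coefficients in the expansion in this basis are non-negative.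
   Formalization: Since p_k is defined only for k ≤ n (extending it to all k makes the claim false: n=2, λ=(3,0), μ=(2,0)), the claim is stated for λ, μ with all parts at most n, and for all λ, μ in P_n with p_λ, p_μ replaced by p_{λ'}, p_{μ'}. *)

theory Defs
  imports Complex_Main "HOL-Library.Poly_Mapping"
begin

text \<open>Polynomials over the rationals in the variables \<open>var 0, var 1, \<dots>\<close>;
  the ring in \<open>n\<close> variables is the part involving only \<open>var i\<close> with \<open>i < n\<close>.\<close>

type_synonym qpoly = "(nat \<Rightarrow>\<^sub>0 nat) \<Rightarrow>\<^sub>0 rat"

definition var :: "nat \<Rightarrow> qpoly" where
  "var i = Poly_Mapping.single (Poly_Mapping.single i 1) 1"

definition const :: "rat \<Rightarrow> qpoly" where
  "const c = Poly_Mapping.single 0 c"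

definition partitions :: "nat \<Rightarrow> nat list set" where
  "partitions n = {v. length v = n \<and> sorted_wrt (\<ge>) v}"

definition contains :: "nat list \<Rightarrow> nat list \<Rightarrow> bool" where
  "contains v w \<longleftrightarrow> list_all2 (\<ge>) v w"

text \<open>For a weakly decreasing list, the head is the largest part, hence the length of
  the conjugate. Conjugates are returned without trailing zeros.\<close>

fun conjugate :: "nat list \<Rightarrow> nat list" where
  "conjugate [] = []"
| "conjugate (a # v) = map (\<lambda>j. length (filter (\<lambda>b. j < b) (a # v))) [0..<a]"

text \<open>The value of the power sum at a point \<open>y\<close> of an arbitrary commutative ring.
  The generic point \<open>var\<close> gives the polynomial itself.\<close>

definition power_sum :: "nat \<Rightarrow> nat \<Rightarrow> (nat \<Rightarrow> 'a::comm_ring_1) \<Rightarrow> 'a" where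
  "power_sum n k y = (\<Sum>i<n. y i ^ k)"

text \<open>Only nonzero parts contribute a factor; the zero partition has the
  conventional value \<open>n\<close> (not the empty product \<open>1\<close>).\<close>

definition power_sum_part :: "nat \<Rightarrow> nat list \<Rightarrow> (nat \<Rightarrow> 'a::comm_ring_1) \<Rightarrow> 'a" where
  "power_sum_part n v y =
     (if \<forall>a\<in>set v. a = 0 then of_nat n
      else prod_list (map (\<lambda>k. power_sum n k y) (filter (\<lambda>k. k \<noteq> 0) v)))"

text \<open>The polynomial \<open>p\<^sub>v(x + 1) / p\<^sub>v(1)\<close>.\<close>

definition shifted_ratio :: "nat \<Rightarrow> nat list \<Rightarrow> qpoly" where
  "shifted_ratio n v =
     const (1 / power_sum_part n v (\<lambda>_. 1)) * power_sum_part n v (\<lambda>i. var i + 1)"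

text \<open>The function \<open>c\<close> is a coefficient family of \<open>f\<close> with respect to the basis of all
  \<open>p\<^bsub>\<nu>'\<^esub>\<close> with \<open>\<nu>\<close> in \<open>partitions n\<close>.\<close>

definition power_sum_expansion :: "nat \<Rightarrow> (nat list \<Rightarrow> rat) \<Rightarrow> qpoly \<Rightarrow> bool" where
  "power_sum_expansion n c f \<longleftrightarrow>
     finite {\<nu> \<in> partitions n. c \<nu> \<noteq> 0} \<and>
     f = (\<Sum>\<nu> \<in> {\<nu> \<in> partitions n. c \<nu> \<noteq> 0}.
            const (c \<nu>) * power_sum_part n (conjugate \<nu>) var)"

definition power_sum_positive :: "nat \<Rightarrow> qpoly \<Rightarrow> bool" where
  "power_sum_positive n f \<longleftrightarrow>
     (\<exists>c. power_sum_expansion n c f \<and> (\<forall>\<nu> \<in> partitions n. c \<nu> \<ge> 0))"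

end

theory Submission
  imports Defs
    "HOL-Computational_Algebra.Fundamental_Theorem_Algebra"
    "HOL-Library.Nonpos_Ints"
    "HOL-Computational_Algebra.Polynomial_FPS"
begin

text \<open>
  Put \<open>q\<^sub>j = p\<^sub>j / n\<close>, so that \<open>q\<^sub>0 = 1\<close>. By the binomial theorem the shifted ratio of
  \<open>v\<close> is the product over the parts \<open>k\<close> of \<open>v\<close> of the factors
  \<open>f\<^sub>k = (\<Sum>j\<le>k. (k choose j) q\<^sub>j)\<close>, where \<open>f\<^sub>0 = 1\<close>; zero parts therefore contribute nothing.
  Both halves of the theorem follow from one criterion for weakly decreasing lists \<open>v\<close>, \<open>w\<close> with
  parts at most \<open>n\<close>: the difference of the shifted ratios is power sum positive iff, for
  every \<open>j\<close>, \<open>v\<close> has at least as many parts exceeding \<open>j\<close> as \<open>w\<close>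
  (lemma \<open>power_sum_positive_shifted_ratio_diff_iff\<close>). These counts are the parts of the conjugate,
  so the criterion expresses containment, both for the partitions and for their conjugates.

  If the counts dominate, then so do the parts, and the difference of the products telescopes into
  summands \<open>(f\<^sub>a - f\<^sub>b) g\<close> and \<open>f\<^sub>b g\<close> with \<open>b \<le> a\<close>. Since \<open>(b choose j) \<le> (a choose j)\<close>,
  the first factors are non-negative combinations of \<open>p\<^sub>0, \<dots>, p\<^sub>n\<close>. It remains to see
  that multiplication by these preserves positivity, which holds because any product of power sums of
  degrees \<open>1, \<dots>, n\<close> is indexed by the conjugate of a partition of length at most \<open>n\<close>.

  Conversely, a power sum positive polynomial is non-negative at every complex point where all of
  \<open>p\<^sub>1, \<dots>, p\<^sub>n\<close> are real and non-negative, and over the complex numbers these values can be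
  prescribed at will: Newton's identities turn them into elementary symmetric functions, and a
  polynomial with the corresponding coefficients splits into linear factors. Choose a point with
  \<open>q\<^sub>m = T\<close> and all other \<open>q\<^sub>j\<close> zero (\<open>1 \<le> j \<le> n\<close>). There the shifted ratio of \<open>v\<close>
  equals the product of \<open>1 + (k choose m) T\<close> over the parts \<open>k\<close>, a polynomial in \<open>T\<close>
  whose degree is the number of parts that are at least \<open>m\<close>. Letting \<open>T\<close> grow compares the
  degrees, hence the counts.
\<close>

section \<open>Power sums with prescribed values\<close>

text \<open>Newton's identities as a logarithmic derivative:
  \<open>log (1 - x X)\<close> has derivative \<open>- x / (1 - x X)\<close>, whose expansion is the geometric series
  of the powers of \<open>x\<close>.\<close>

lemma newton_identity_fps:
  fixes xs :: "'a::field list"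
  defines "F \<equiv> fps_of_poly (\<Prod>x\<leftarrow>xs. [:1, -x:])"
  shows "fps_deriv F = - (F * Abs_fps (\<lambda>k. \<Sum>x\<leftarrow>xs. x ^ Suc k))"
  unfolding F_def
proof (induction xs)
  case Nil
  then show ?case by (simp add: fps_eq_iff fps_mult_nth)
next
  case (Cons y ys)
  let ?L = "fps_of_poly [:1, -y:]"
  let ?G = "fps_of_poly (\<Prod>x\<leftarrow>ys. [:1, -x:])"
  let ?S = "Abs_fps (\<lambda>k. \<Sum>x\<leftarrow>ys. x ^ Suc k)"
  let ?H = "Abs_fps (\<lambda>k. y ^ Suc k)"
  have L: "?L = 1 - fps_const y * fps_X"
    by (simp add: fps_of_poly_pCons)
  have LH: "?L * ?H = fps_const y"
  proof (rule fps_ext)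
    fix k
    show "fps_nth (?L * ?H) k = fps_nth (fps_const y) k"
      unfolding L by (cases k) (simp_all add: left_diff_distrib mult.assoc)
  qed
  have L': "fps_deriv ?L = - fps_const y"
    unfolding L by simp
  have S: "Abs_fps (\<lambda>k. \<Sum>x\<leftarrow>y # ys. x ^ Suc k) = ?H + ?S"
    by (simp add: fps_eq_iff)
  have "fps_deriv (?L * ?G) = - (fps_const y) * ?G + ?L * - (?G * ?S)"
    by (simp only: fps_deriv_mult L' Cons.IH) (simp add: algebra_simps)
  also have "\<dots> = - (?L * ?G * (?H + ?S))"
    unfolding LH[symmetric] by (simp add: algebra_simps)
  finally show ?case
    unfolding S by (simp only: list.map prod_list.Cons fps_of_poly_mult)
qed

text \<open>Newton's recurrence, solved for the signed elementary symmetric functions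
  \<open>(-1)\<^sup>k e\<^sub>k\<close> that belong to the power sums \<open>a 1, a 2, \<dots>\<close>.\<close>

fun elem_from_power_sums :: "(nat \<Rightarrow> 'a::field) \<Rightarrow> nat \<Rightarrow> 'a" where
  "elem_from_power_sums a 0 = 1"
| "elem_from_power_sums a (Suc k) =
     - (\<Sum>j\<le>k. elem_from_power_sums a j * a (Suc (k - j))) / of_nat (Suc k)"

text \<open>The reversed polynomial is monic of degree exactly \<open>n\<close>, so it has \<open>n\<close> roots
  with multiplicity. When the degree drops under reversal, some roots are zero.\<close>

lemma ex_prod_linear_factors:
  fixes e :: "nat \<Rightarrow> 'a::alg_closed_field"
  assumes "e 0 = 1"
  shows "\<exists>xs. length xs = n \<and> (\<forall>k\<le>n. coeff (\<Prod>x\<leftarrow>xs. [:1, -x:]) k = e k)"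
proof -
  define p where "p = (\<Sum>k\<le>n. monom (e (n - k)) k)"
  have cp: "coeff p k = (if k \<le> n then e (n - k) else 0)" for k
    by (simp add: p_def coeff_sum)
  have deg: "degree p = n"
  proof (rule antisym)
    show "degree p \<le> n" by (rule degree_le) (simp add: cp)
    show "n \<le> degree p" by (rule le_degree) (simp add: cp assms)
  qed
  then have lc: "lead_coeff p = 1" by (simp add: cp assms)
  then have "p \<noteq> 0" by auto
  then obtain A where A: "size A = degree p"
      "p = smult (lead_coeff p) (\<Prod>x\<in>#A. [:-x, 1:])"
    using alg_closed_imp_factorization by blast
  obtain xs where xs: "A = mset xs" by (metis ex_mset)
  have p: "p = (\<Prod>x\<leftarrow>xs. [:-x, 1:])"
    using A(2) lc by (simp add: xs prod_mset_prod_list flip: mset_map)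
  have "reflect_poly [:-x, 1:] = [:1, -x:]" for x :: 'a
    by (cases "x = 0") (simp_all add: reflect_poly_def)
  then have "reflect_poly p = (\<Prod>x\<leftarrow>xs. [:1, -x:])"
    by (simp add: p reflect_poly_prod_list o_def)
  moreover have "coeff (reflect_poly p) k = e k" if "k \<le> n" for k
    using that by (simp add: coeff_reflect_poly deg cp)
  ultimately show ?thesis
    using A(1) deg xs by (intro exI[of _ xs]) simp
qed

text \<open>Newton's recurrence can be solved in both directions, so roots with the right elementary
  symmetric functions also have the right power sums. The first \<open>n\<close> coefficients govern exactly the first
  \<open>n\<close> power sums, hence the bound on \<open>k\<close>.\<close>

lemma ex_point_with_power_sums:
  fixes a :: "nat \<Rightarrow> 'a::{alg_closed_field, field_char_0}"
  shows "\<exists>x. \<forall>k\<in>{1..n}. power_sum n k x = a k"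
proof -
  define e where "e = elem_from_power_sums a"
  obtain xs where len: "length xs = n"
    and xs: "\<And>k. k \<le> n \<Longrightarrow> coeff (\<Prod>x\<leftarrow>xs. [:1, -x:]) k = e k"
    using ex_prod_linear_factors[of e n] by (auto simp: e_def)
  define s where "s k = (\<Sum>x\<leftarrow>xs. x ^ k)" for k
  let ?F = "fps_of_poly (\<Prod>x\<leftarrow>xs. [:1, -x:])"
  have newton: "of_nat (Suc k) * e (Suc k) = - (\<Sum>j\<le>k. e j * s (Suc (k - j)))"
    if "k < n" for k
  proof -
    have "fps_nth (fps_deriv ?F) k = fps_nth (- (?F * Abs_fps (\<lambda>k. s (Suc k)))) k"
      unfolding s_def by (simp only: newton_identity_fps)
    then show ?thesis
      using that by (simp add: fps_mult_nth xs atMost_atLeast0)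
  qed
  have rec: "of_nat (Suc k) * e (Suc k) = - (\<Sum>j\<le>k. e j * a (Suc (k - j)))" for k
    by (simp add: e_def del: of_nat_Suc)
  have s_eq: "s (Suc k) = a (Suc k)" if "k < n" for k
    using that
  proof (induction k rule: less_induct)
    case (less k)
    have split: "(\<Sum>j\<le>k. e j * b (Suc (k - j))) =
        b (Suc k) + (\<Sum>j\<in>{1..k}. e j * b (Suc (k - j)))" for b
    proof -
      have "{..k} = insert 0 {1..k}" by auto
      then show ?thesis by (simp add: e_def)
    qed
    have "(\<Sum>j\<in>{1..k}. e j * s (Suc (k - j))) = (\<Sum>j\<in>{1..k}. e j * a (Suc (k - j)))"
      using less by (intro sum.cong) auto
    with newton[OF less.prems] rec[of k] show ?case
      unfolding split by simp
  qed
  have "power_sum n k (\<lambda>i. xs ! i) = s k" for k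
    by (simp add: power_sum_def s_def sum_list_sum_nth len atLeast0LessThan)
  then have "\<forall>k\<in>{1..n}. power_sum n k (\<lambda>i. xs ! i) = a k"
    using s_eq by (metis Suc_le_eq Suc_pred atLeastAtMost_iff less_eq_Suc_le One_nat_def)
  then show ?thesis by blast
qed

section \<open>Evaluation at complex points\<close>

definition monom_at :: "(nat \<Rightarrow> complex) \<Rightarrow> (nat \<Rightarrow>\<^sub>0 nat) \<Rightarrow> complex" where
  "monom_at x k = (\<Prod>i\<in>Poly_Mapping.keys k. x i ^ Poly_Mapping.lookup k i)"

definition eval_at :: "(nat \<Rightarrow> complex) \<Rightarrow> qpoly \<Rightarrow> complex" where
  "eval_at x f = (\<Sum>k\<in>Poly_Mapping.keys f. of_rat (Poly_Mapping.lookup f k) * monom_at x k)"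

lemma monom_at_0 [simp]: "monom_at x 0 = 1"
  by (simp add: monom_at_def)

lemma monom_at_add: "monom_at x (k + l) = monom_at x k * monom_at x l"
proof -
  let ?K = "Poly_Mapping.keys k \<union> Poly_Mapping.keys l"
  have sup: "monom_at x m = (\<Prod>i\<in>?K. x i ^ Poly_Mapping.lookup m i)"
    if "Poly_Mapping.keys m \<subseteq> ?K" for m
    unfolding monom_at_def using that
    by (intro prod.mono_neutral_left) (auto simp: in_keys_iff)
  show ?thesis
    using Poly_Mapping.keys_add[of k l]
    by (simp add: sup lookup_add power_add prod.distrib)
qed

lemma eval_at_single: "eval_at x (Poly_Mapping.single k c) = of_rat c * monom_at x k"
  by (simp add: eval_at_def)

lemma eval_at_0 [simp]: "eval_at x 0 = 0"
  by (simp add: eval_at_def)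

lemma eval_at_const [simp]: "eval_at x (const c) = of_rat c"
  by (simp add: const_def eval_at_single)

lemma eval_at_1 [simp]: "eval_at x 1 = 1"
  using eval_at_const[of x 1] by (simp add: const_def)

lemma eval_at_var [simp]: "eval_at x (var i) = x i"
  by (simp add: var_def eval_at_single monom_at_def)

lemma eval_at_add [simp]: "eval_at x (f + g) = eval_at x f + eval_at x g"
  unfolding eval_at_def
  by (rule setsum_keys_plus_distrib) (simp_all add: of_rat_add algebra_simps)

lemma eval_at_diff [simp]: "eval_at x (f - g) = eval_at x f - eval_at x g"
  using eval_at_add[of x "f - g" g] by simp

lemma poly_mapping_single_add_induct [case_names zero add]:
  assumes "P 0" and "\<And>k c f. P f \<Longrightarrow> P (Poly_Mapping.single k c + f)"
  shows "P f"
proof (induction f rule: update_induct)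
  case (update f a b)
  have "Poly_Mapping.update a b f = Poly_Mapping.single a b + f"
    using update.hyps(1)
    by (intro poly_mapping_eqI)
      (auto simp: lookup_update lookup_add lookup_single when_def in_keys_iff)
  with assms(2)[OF update.IH] show ?case by simp
qed (fact assms(1))

lemma eval_at_single_mult:
  "eval_at x (Poly_Mapping.single k c * g) = of_rat c * monom_at x k * eval_at x g"
proof (induction g rule: poly_mapping_single_add_induct)
  case (add l d g)
  then show ?case
    by (simp add: distrib_left mult_single eval_at_single monom_at_add of_rat_mult)
qed simp

lemma eval_at_mult [simp]: "eval_at x (f * g) = eval_at x f * eval_at x g"
  by (induction f rule: poly_mapping_single_add_induct)
    (simp_all add: distrib_right eval_at_single_mult eval_at_single)

lemma eval_at_sum [simp]: "eval_at x (sum f A) = (\<Sum>i\<in>A. eval_at x (f i))"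
  by (induction A rule: infinite_finite_induct) simp_all

lemma eval_at_power [simp]: "eval_at x (f ^ k) = eval_at x f ^ k"
  by (induction k) simp_all

lemma eval_at_of_nat [simp]: "eval_at x (of_nat k) = of_nat k"
  by (induction k) simp_all

lemma eval_at_prod_list [simp]: "eval_at x (prod_list fs) = (\<Prod>f\<leftarrow>fs. eval_at x f)"
  by (induction fs) simp_all

lemma eval_at_power_sum [simp]: "eval_at x (power_sum n k var) = power_sum n k x"
  by (simp add: power_sum_def)

lemma eval_at_power_sum_part [simp]:
  "eval_at x (power_sum_part n v var) = power_sum_part n v x"
  unfolding power_sum_part_def if_distrib[of "eval_at x"]
  by (simp only: eval_at_of_nat eval_at_prod_list list.map_comp o_def eval_at_power_sum)

section \<open>Counting parts\<close>

definition parts_above :: "nat \<Rightarrow> nat list \<Rightarrow> nat" where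
  "parts_above j v = length (filter (\<lambda>b. j < b) v)"

lemma parts_above_Nil [simp]: "parts_above j [] = 0"
  by (simp add: parts_above_def)

lemma parts_above_Cons [simp]:
  "parts_above j (a # v) = (if j < a then Suc (parts_above j v) else parts_above j v)"
  by (simp add: parts_above_def)

lemma parts_above_eq_0: "\<forall>b\<in>set v. b \<le> j \<Longrightarrow> parts_above j v = 0"
  by (induction v) auto

text \<open>The parts exceeding \<open>j\<close> form an initial segment of a weakly decreasing list. This is the
  symmetry of Young diagrams on which all facts about conjugates below rest.\<close>

lemma less_parts_above_iff:
  assumes "sorted_wrt (\<ge>) v"
  shows "i < parts_above j v \<longleftrightarrow> i < length v \<and> j < v ! i"
  using assms
proof (induction v arbitrary: i)
  case (Cons a v)
  show ?case
  proof (cases "j < a")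
    case True
    then show ?thesis using Cons by (cases i) auto
  next
    case False
    then have "parts_above j v = 0"
      using Cons.prems by (intro parts_above_eq_0) auto
    moreover have "\<not> j < (a # v) ! i" if "i < Suc (length v)"
      using False that Cons.prems by (cases i) (force dest: nth_mem)+
    ultimately show ?thesis using False by auto
  qed
qed simp

lemma contains_iff_parts_above:
  assumes "sorted_wrt (\<ge>) v" "sorted_wrt (\<ge>) w" "length v = length w"
  shows "contains v w \<longleftrightarrow> (\<forall>j. parts_above j w \<le> parts_above j v)"
proof
  assume "contains v w"
  then have le: "w ! i \<le> v ! i" if "i < length w" for i
    using that by (simp add: contains_def list_all2_conv_all_nth)
  show "\<forall>j. parts_above j w \<le> parts_above j v"
  proof (intro allI leI notI)
    fix j assume "parts_above j v < parts_above j w"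
    then show False
      using less_parts_above_iff[OF assms(1), of "parts_above j v" j]
        less_parts_above_iff[OF assms(2), of "parts_above j v" j]
        le[of "parts_above j v"] assms(3) by auto
  qed
next
  assume *: "\<forall>j. parts_above j w \<le> parts_above j v"
  have "w ! i \<le> v ! i" if "i < length w" for i
    using less_parts_above_iff[OF assms(1), of i "v ! i"]
      less_parts_above_iff[OF assms(2), of i "v ! i"] * that
    by (meson leI less_le_trans nat_less_le)
  then show "contains v w"
    using assms(3) by (simp add: contains_def list_all2_conv_all_nth)
qed

lemma conjugate_eq_map_parts_above:
  "v \<noteq> [] \<Longrightarrow> conjugate v = map (\<lambda>j. parts_above j v) [0..<hd v]"
  by (cases v) (simp_all add: parts_above_def)

lemma parts_above_map_parts_above:
  assumes "sorted_wrt (\<ge>) w" "\<forall>b\<in>set w. b \<le> N"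
  shows "parts_above i (map (\<lambda>j. parts_above j w) [0..<N]) = (if i < length w then w ! i else 0)"
proof -
  have "parts_above i (map (\<lambda>j. parts_above j w) [0..<N]) =
      card {j. j < N \<and> i < parts_above j w}"
    by (simp add: parts_above_def[of i] filter_map o_def length_filter_conv_card cong: conj_cong)
  also have "{j. j < N \<and> i < parts_above j w} = (if i < length w then {..<w ! i} else {})"
    using assms(2) nth_mem[of i w]
    by (auto simp: less_parts_above_iff[OF assms(1)] intro: less_le_trans)
  finally show ?thesis by simp
qed

lemma sorted_map_parts_above: "sorted_wrt (\<ge>) (map (\<lambda>j. parts_above j w) [0..<N])"
proof -
  have "parts_above j w \<le> parts_above i w" if "i \<le> j" for i j
    using that by (induction w) auto
  then show ?thesis by (auto simp: sorted_wrt_iff_nth_less)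
qed

lemma sorted_conjugate: "sorted_wrt (\<ge>) (conjugate v)"
  by (cases "v = []") (simp_all add: conjugate_eq_map_parts_above sorted_map_parts_above del: conjugate.simps(2))

lemma parts_above_conjugate:
  assumes "sorted_wrt (\<ge>) v"
  shows "parts_above i (conjugate v) = (if i < length v then v ! i else 0)"
proof (cases "v = []")
  case False
  then have "\<forall>b\<in>set v. b \<le> hd v" using assms by (cases v) auto
  with False assms show ?thesis
    by (simp add: conjugate_eq_map_parts_above parts_above_map_parts_above)
qed simp

lemma contains_iff_parts_above_conjugate:
  assumes "sorted_wrt (\<ge>) v" "sorted_wrt (\<ge>) w" "length v = length w"
  shows "contains v w \<longleftrightarrow> (\<forall>j. parts_above j (conjugate w) \<le> parts_above j (conjugate v))"
  using assms by (auto simp: parts_above_conjugate contains_def list_all2_conv_all_nth)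

lemma conjugate_parts_le: "b \<in> set (conjugate v) \<Longrightarrow> b \<le> length v"
  by (cases v) (auto split: if_splits simp: le_SucI)

text \<open>The preimage is the conjugate of \<open>w\<close> padded with zeros to length \<open>n\<close>; the bound
  on the parts of \<open>w\<close> makes \<open>n\<close> entries sufficient.\<close>

lemma ex_partition_conjugate_eq:
  assumes "sorted_wrt (\<ge>) w" "\<forall>b\<in>set w. 0 < b \<and> b \<le> n" "n \<ge> 1"
  shows "\<exists>v\<in>partitions n. conjugate v = w"
proof
  let ?v = "map (\<lambda>j. parts_above j w) [0..<n]"
  show "?v \<in> partitions n"
    by (simp add: partitions_def sorted_map_parts_above)
  have "hd ?v = parts_above 0 w"
    using assms(3) by (simp add: hd_map)
  also have "parts_above 0 w = length w"
    using assms(2) by (induction w) auto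
  finally have "conjugate ?v = map (\<lambda>j. parts_above j ?v) [0..<length w]"
    using assms(3) by (simp add: conjugate_eq_map_parts_above)
  also have "\<dots> = w"
    using assms by (intro nth_equalityI) (simp_all add: parts_above_map_parts_above)
  finally show "conjugate ?v = w" .
qed

section \<open>The cone of power sum positive polynomials\<close>

lemma const_0 [simp]: "const 0 = 0"
  by (simp add: const_def)

lemma const_1 [simp]: "const 1 = 1"
  by (simp add: const_def)

lemma const_add: "const (a + b) = const a + const b"
  by (simp add: const_def single_add)

lemma const_mult: "const (a * b) = const a * const b"
  by (simp add: const_def mult_single)

lemma const_of_nat: "const (of_nat k) = of_nat k"
  by (simp add: const_def)

text \<open>The index set need not be the support of the coefficients. This freedom makes the closure
  properties of the cone easy to prove.\<close>

lemma power_sum_positive_iff: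
  "power_sum_positive n f \<longleftrightarrow>
     (\<exists>c A. finite A \<and> A \<subseteq> partitions n \<and> (\<forall>\<nu>\<in>A. c \<nu> \<ge> 0) \<and>
        f = (\<Sum>\<nu>\<in>A. const (c \<nu>) * power_sum_part n (conjugate \<nu>) var))"
proof
  assume "power_sum_positive n f"
  then show "\<exists>c A. finite A \<and> A \<subseteq> partitions n \<and> (\<forall>\<nu>\<in>A. c \<nu> \<ge> 0) \<and>
        f = (\<Sum>\<nu>\<in>A. const (c \<nu>) * power_sum_part n (conjugate \<nu>) var)"
    unfolding power_sum_positive_def power_sum_expansion_def by blast
next
  assume "\<exists>c A. finite A \<and> A \<subseteq> partitions n \<and> (\<forall>\<nu>\<in>A. c \<nu> \<ge> 0) \<and>
        f = (\<Sum>\<nu>\<in>A. const (c \<nu>) * power_sum_part n (conjugate \<nu>) var)"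
  then obtain c A where A: "finite A" "A \<subseteq> partitions n" "\<forall>\<nu>\<in>A. c \<nu> \<ge> 0"
    and f: "f = (\<Sum>\<nu>\<in>A. const (c \<nu>) * power_sum_part n (conjugate \<nu>) var)" by blast
  define d where "d \<nu> = (if \<nu> \<in> A then c \<nu> else 0)" for \<nu>
  have sub: "{\<nu> \<in> partitions n. d \<nu> \<noteq> 0} \<subseteq> A"
    by (auto simp: d_def split: if_splits)
  have "f = (\<Sum>\<nu>\<in>A. const (d \<nu>) * power_sum_part n (conjugate \<nu>) var)"
    unfolding f by (intro sum.cong) (simp_all add: d_def)
  also have "\<dots> = (\<Sum>\<nu>\<in>{\<nu> \<in> partitions n. d \<nu> \<noteq> 0}.
      const (d \<nu>) * power_sum_part n (conjugate \<nu>) var)"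
    using A sub by (intro sum.mono_neutral_right) auto
  finally show "power_sum_positive n f"
    unfolding power_sum_positive_def power_sum_expansion_def
    using finite_subset[OF sub A(1)] A(3) by (intro exI[of _ d]) (auto simp: d_def)
qed

lemma power_sum_positive_0 [simp]: "power_sum_positive n 0"
  unfolding power_sum_positive_iff by (intro exI[of _ "\<lambda>_. 0"] exI[of _ "{}"]) simp

lemma power_sum_positive_basis:
  assumes "\<nu> \<in> partitions n" "c \<ge> 0"
  shows "power_sum_positive n (const c * power_sum_part n (conjugate \<nu>) var)"
  unfolding power_sum_positive_iff using assms
  by (intro exI[of _ "\<lambda>_. c"] exI[of _ "{\<nu>}"]) simp

lemma power_sum_positive_add:
  assumes "power_sum_positive n f" "power_sum_positive n g"
  shows "power_sum_positive n (f + g)"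
proof -
  let ?S = "\<lambda>c A. \<Sum>\<nu>\<in>A. const (c \<nu>) * power_sum_part n (conjugate \<nu>) var"
  obtain c A where A: "finite A" "A \<subseteq> partitions n" "\<forall>\<nu>\<in>A. c \<nu> \<ge> 0" "f = ?S c A"
    using assms(1) unfolding power_sum_positive_iff by blast
  obtain d B where B: "finite B" "B \<subseteq> partitions n" "\<forall>\<nu>\<in>B. d \<nu> \<ge> 0" "g = ?S d B"
    using assms(2) unfolding power_sum_positive_iff by blast
  define c' where "c' \<nu> = (if \<nu> \<in> A then c \<nu> else 0)" for \<nu>
  define d' where "d' \<nu> = (if \<nu> \<in> B then d \<nu> else 0)" for \<nu>
  have "f = ?S c' (A \<union> B)"
    unfolding A(4) using A(1) B(1) by (intro sum.mono_neutral_cong_left) (auto simp: c'_def)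
  moreover have "g = ?S d' (A \<union> B)"
    unfolding B(4) using A(1) B(1) by (intro sum.mono_neutral_cong_left) (auto simp: d'_def)
  ultimately have "f + g = ?S (\<lambda>\<nu>. c' \<nu> + d' \<nu>) (A \<union> B)"
    by (simp add: const_add distrib_right sum.distrib)
  moreover have "\<forall>\<nu>\<in>A \<union> B. c' \<nu> + d' \<nu> \<ge> 0"
    using A(3) B(3) by (auto simp: c'_def d'_def)
  ultimately show ?thesis
    unfolding power_sum_positive_iff using A B
    by (intro exI[of _ "\<lambda>\<nu>. c' \<nu> + d' \<nu>"] exI[of _ "A \<union> B"]) auto
qed

lemma power_sum_positive_sum:
  "(\<And>i. i \<in> A \<Longrightarrow> power_sum_positive n (f i)) \<Longrightarrow> power_sum_positive n (sum f A)"
  by (induction A rule: infinite_finite_induct) (simp_all add: power_sum_positive_add)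

text \<open>Sorting the factors exhibits the product as a basis element. The empty product is
  \<open>1\<close>, whereas the zero partition stands for the constant \<open>n\<close>, so that case is rescaled.\<close>

lemma power_sum_positive_prod_list:
  assumes "n \<ge> 1" "\<forall>b\<in>set w. 0 < b \<and> b \<le> n" "c \<ge> 0"
  shows "power_sum_positive n (const c * (\<Prod>k\<leftarrow>w. power_sum n k var))"
proof -
  define w' where "w' = rev (sort w)"
  have "sorted_wrt (\<ge>) w'" by (simp add: w'_def sorted_wrt_rev)
  moreover have set: "set w' = set w" by (simp add: w'_def)
  ultimately obtain \<nu> where \<nu>: "\<nu> \<in> partitions n" "conjugate \<nu> = w'"
    using ex_partition_conjugate_eq[of w' n] assms by auto
  have "mset w' = mset w" by (simp add: w'_def)
  then have prod_eq: "(\<Prod>k\<leftarrow>w. power_sum n k var) = (\<Prod>k\<leftarrow>w'. power_sum n k var :: qpoly)"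
    by (metis mset_map prod_mset_prod_list)
  show ?thesis
  proof (cases "w = []")
    case True
    then have "const c * (\<Prod>k\<leftarrow>w. power_sum n k var) =
        const (c / of_nat n) * power_sum_part n (conjugate \<nu>) var"
      using assms(1) \<nu>(2) set
      by (simp add: power_sum_part_def flip: const_of_nat const_mult)
    then show ?thesis
      using power_sum_positive_basis[OF \<nu>(1)] assms(3) by simp
  next
    case False
    then have "\<not> (\<forall>a\<in>set w'. a = 0)"
      using set assms(2) by (metis less_irrefl list.set_sel(1))
    moreover have "filter (\<lambda>k. k \<noteq> 0) w' = w'"
      using set assms(2) by (auto simp: filter_id_conv)
    ultimately have "(\<Prod>k\<leftarrow>w. power_sum n k var) = power_sum_part n (conjugate \<nu>) var"
      unfolding power_sum_part_def \<nu>(2) prod_eq by (simp only: if_False)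
    then show ?thesis
      using power_sum_positive_basis[OF \<nu>(1) assms(3)] by simp
  qed
qed

lemma power_sum_positive_1: "n \<ge> 1 \<Longrightarrow> power_sum_positive n 1"
  using power_sum_positive_prod_list[of n "[]" 1] by simp

lemma power_sum_0: "power_sum n 0 x = of_nat n"
  by (simp add: power_sum_def)

lemma power_sum_positive_mult_power_sum:
  assumes "n \<ge> 1" "k \<le> n" "c \<ge> 0" "power_sum_positive n f"
  shows "power_sum_positive n (const c * power_sum n k var * f)"
proof -
  obtain d A where A: "A \<subseteq> partitions n" "\<forall>\<nu>\<in>A. d \<nu> \<ge> 0"
    and f: "f = (\<Sum>\<nu>\<in>A. const (d \<nu>) * power_sum_part n (conjugate \<nu>) var)"
    using assms(4) unfolding power_sum_positive_iff by blast
  have "power_sum_positive n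
      (const c * power_sum n k var * (const (d \<nu>) * power_sum_part n (conjugate \<nu>) var))"
    if "\<nu> \<in> A" for \<nu>
  proof -
    define w where "w = filter (\<lambda>k. k \<noteq> 0) (conjugate \<nu>)"
    have w: "\<forall>b\<in>set w. 0 < b \<and> b \<le> n"
      using conjugate_parts_le[of _ \<nu>] A(1) that by (auto simp: w_def partitions_def)
    \<comment> \<open>The scalar absorbs the value \<open>n\<close> of the zero partition.\<close>
    obtain r :: rat where r: "r \<ge> 0"
      and part: "power_sum_part n (conjugate \<nu>) var = const r * (\<Prod>k\<leftarrow>w. power_sum n k var)"
    proof (cases "\<forall>a\<in>set (conjugate \<nu>). a = 0")
      case True
      then have "w = []" by (auto simp: w_def filter_empty_conv)
      with True show ?thesis
        by (intro that[of "of_nat n"]) (simp_all add: power_sum_part_def const_of_nat)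
    next
      case False
      then show ?thesis
        by (intro that[of 1]) (auto simp: power_sum_part_def w_def)
    qed
    have r': "c * d \<nu> * r \<ge> 0" "c * d \<nu> * r * of_nat n \<ge> 0"
      using r assms(3) A(2) that by simp_all
    show ?thesis
    proof (cases "k = 0")
      case True
      have "const c * power_sum n k var * (const (d \<nu>) * power_sum_part n (conjugate \<nu>) var) =
          const (c * d \<nu> * r * of_nat n) * (\<Prod>k\<leftarrow>w. power_sum n k var)"
        by (simp add: True power_sum_0 part const_mult const_of_nat mult_ac)
      then show ?thesis
        using power_sum_positive_prod_list[OF assms(1) w r'(2)] by simp
    next
      case False
      have "const c * power_sum n k var * (const (d \<nu>) * power_sum_part n (conjugate \<nu>) var) =
          const (c * d \<nu> * r) * (\<Prod>k\<leftarrow>k # w. power_sum n k var)"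
        by (simp only: part const_mult list.map prod_list.Cons mult_ac)
      moreover have "\<forall>b\<in>set (k # w). 0 < b \<and> b \<le> n"
        using w False assms(2) by simp
      ultimately show ?thesis
        using power_sum_positive_prod_list[OF assms(1) _ r'(1)] by (simp only:)
    qed
  qed
  then show ?thesis
    unfolding f sum_distrib_left by (intro power_sum_positive_sum) auto
qed

section \<open>Binomial factors of the shifted ratio\<close>

text \<open>Defined by the expansion in power sums, from which positivity is read off; the form
  \<open>p\<^sub>k(x + 1) / n\<close> is recovered in \<open>shifted_factor_eq\<close>.\<close>

definition shifted_factor :: "nat \<Rightarrow> nat \<Rightarrow> qpoly" where
  "shifted_factor n k = (\<Sum>j\<le>k. const (of_nat (k choose j) / of_nat n) * power_sum n j var)"

lemma shifted_factor_0: "n \<ge> 1 \<Longrightarrow> shifted_factor n 0 = 1"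
  by (simp add: shifted_factor_def power_sum_0 flip: const_of_nat const_mult)

lemma shifted_factor_eq:
  "shifted_factor n k = const (1 / of_nat n) * power_sum n k (\<lambda>i. var i + 1)"
proof -
  have "power_sum n k (\<lambda>i. var i + 1) = (\<Sum>i<n. \<Sum>j\<le>k. of_nat (k choose j) * var i ^ j)"
    by (simp add: power_sum_def binomial_ring)
  also have "\<dots> = (\<Sum>j\<le>k. const (of_nat (k choose j)) * power_sum n j var)"
    by (subst sum.swap) (simp add: power_sum_def sum_distrib_left const_of_nat)
  finally show ?thesis
    by (simp add: shifted_factor_def sum_distrib_left flip: mult.assoc const_mult)
qed

text \<open>The conventional value \<open>n\<close> for the zero partition cancels in the ratio, so no case
  distinction survives, and zero parts contribute the factor \<open>1\<close>.\<close>

lemma shifted_ratio_eq_prod_list: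
  assumes "n \<ge> 1"
  shows "shifted_ratio n v = (\<Prod>k\<leftarrow>v. shifted_factor n k)"
proof -
  have nz: "power_sum n k (\<lambda>_. 1) = (of_nat n :: rat)" for k
    by (simp add: power_sum_def)
  have filt: "(\<Prod>k\<leftarrow>v. shifted_factor n k) = (\<Prod>k\<leftarrow>filter (\<lambda>k. k \<noteq> 0) v. shifted_factor n k)" for v
    using assms by (induction v) (simp_all add: shifted_factor_0)
  show ?thesis
  proof (cases "\<forall>a\<in>set v. a = 0")
    case True
    then have "filter (\<lambda>k. k \<noteq> 0) v = []" by (simp add: filter_empty_conv)
    with True show ?thesis
      using assms filt[of v]
      by (simp add: shifted_ratio_def power_sum_part_def flip: const_of_nat const_mult)
  next
    case False
    have "const (1 / (\<Prod>k\<leftarrow>w. of_nat n)) * (\<Prod>k\<leftarrow>w. power_sum n k (\<lambda>i. var i + 1)) =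
        (\<Prod>k\<leftarrow>w. shifted_factor n k)" for w :: "nat list"
    proof (induction w)
      case (Cons k w)
      have "const (1 / (of_nat n * (\<Prod>k\<leftarrow>w. of_nat n))) =
          const (1 / of_nat n) * const (1 / (\<Prod>k\<leftarrow>w. of_nat n))"
        by (simp flip: const_mult)
      then show ?case
        unfolding list.map prod_list.Cons Cons.IH[symmetric]
        by (simp only: shifted_factor_eq mult_ac)
    qed simp
    then show ?thesis
      unfolding shifted_ratio_def power_sum_part_def if_not_P[OF False] nz filt[of v] .
  qed
qed

text \<open>The coefficients \<open>(a choose j) - (b choose j)\<close> are non-negative because binomial
  coefficients increase in the upper argument.\<close>

lemma power_sum_positive_mult_shifted_factor_diff:
  assumes "n \<ge> 1" "b \<le> a" "a \<le> n" "power_sum_positive n f"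
  shows "power_sum_positive n ((shifted_factor n a - shifted_factor n b) * f)"
proof -
  have "shifted_factor n b =
      (\<Sum>j\<le>a. const (of_nat (b choose j) / of_nat n) * power_sum n j var)"
    unfolding shifted_factor_def using assms(2)
    by (intro sum.mono_neutral_left) (auto simp: binomial_eq_0)
  moreover have "const (x - y) = const x - const y" for x y
    by (simp add: const_def single_diff)
  ultimately have "(shifted_factor n a - shifted_factor n b) * f =
      (\<Sum>j\<le>a. const (of_nat (a choose j) / of_nat n - of_nat (b choose j) / of_nat n)
        * power_sum n j var * f)"
    by (simp add: shifted_factor_def left_diff_distrib sum_subtractf flip: sum_distrib_right)
  moreover have "(b choose j) \<le> (a choose j)" for j
    using assms(2)
  proof (rule lift_Suc_mono_le[rotated])
    show "(i choose j) \<le> (Suc i choose j)" for i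
      by (cases j) simp_all
  qed
  ultimately show ?thesis
    using assms
    by (auto intro!: power_sum_positive_sum power_sum_positive_mult_power_sum divide_right_mono)
qed

lemma power_sum_positive_mult_shifted_factor:
  assumes "n \<ge> 1" "a \<le> n" "power_sum_positive n f"
  shows "power_sum_positive n (shifted_factor n a * f)"
  unfolding shifted_factor_def sum_distrib_right using assms
  by (auto intro!: power_sum_positive_sum power_sum_positive_mult_power_sum)

lemma power_sum_positive_shifted_factors:
  assumes "n \<ge> 1" "\<forall>a\<in>set v. a \<le> n"
  shows "power_sum_positive n (\<Prod>k\<leftarrow>v. shifted_factor n k)"
  using assms(2)
  by (induction v)
    (use assms(1) in \<open>auto intro: power_sum_positive_1 power_sum_positive_mult_shifted_factor\<close>)

text \<open>Telescoping: with first parts \<open>a\<close>, \<open>b\<close> and remaining products \<open>F\<close>, \<open>G\<close>, the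
  difference is \<open>(f\<^sub>a - f\<^sub>b) F + f\<^sub>b (F - G)\<close>. The domination of counts gives \<open>b \<le> a\<close> and
  passes to the tails. Comparing counts rather than parts lets the lengths of the two lists
  differ, as they do for conjugates.\<close>

lemma power_sum_positive_shifted_factors_diff:
  assumes "n \<ge> 1" "sorted_wrt (\<ge>) v" "sorted_wrt (\<ge>) w"
    and "\<forall>a\<in>set v. a \<le> n" "\<forall>a\<in>set w. a \<le> n"
    and "\<forall>j. parts_above j w \<le> parts_above j v"
  shows "power_sum_positive n ((\<Prod>k\<leftarrow>v. shifted_factor n k) - (\<Prod>k\<leftarrow>w. shifted_factor n k))"
  using assms(2-)
proof (induction v arbitrary: w)
  case Nil
  then have "\<forall>b\<in>set w. b = 0"
    by (auto simp: parts_above_def filter_empty_conv dest: spec[of _ 0])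
  then have "(\<Prod>k\<leftarrow>w. shifted_factor n k) = 1"
    using assms(1) by (induction w) (simp_all add: shifted_factor_0)
  then show ?case by simp
next
  case (Cons a v)
  let ?F = "\<lambda>v. \<Prod>k\<leftarrow>v. shifted_factor n k"
  have pos: "power_sum_positive n (?F v)"
    using Cons.prems(3) assms(1) by (intro power_sum_positive_shifted_factors) auto
  show ?case
  proof (cases w)
    case Nil
    have "?F (a # v) - ?F w = (shifted_factor n a - shifted_factor n 0) * ?F v + (?F v - ?F [])"
      using assms(1) by (simp add: Nil shifted_factor_0 algebra_simps)
    then show ?thesis
      using Cons assms(1) pos
      by (auto intro!: power_sum_positive_add power_sum_positive_mult_shifted_factor_diff
          simp del: list.map prod_list.Cons prod_list.Nil)
  next
    case (Cons b u)
    have head: "b \<le> a"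
    proof (rule ccontr)
      assume "\<not> b \<le> a"
      then have "parts_above a w > 0" "parts_above a (a # v) = 0"
        using Cons.prems(1) by (auto simp: Cons intro!: parts_above_eq_0)
      then show False using Cons.prems(5) by (metis not_le)
    qed
    have tail: "\<forall>j. parts_above j u \<le> parts_above j v"
    proof
      fix j
      show "parts_above j u \<le> parts_above j v"
        \<comment> \<open>Below \<open>b\<close> both counts lose one; from \<open>b\<close> on, \<open>u\<close> contributes nothing.\<close>
      proof (cases "j < b")
        case True
        then show ?thesis
          using head Cons.prems(5)[rule_format, of j] by (simp add: Cons)
      next
        case False
        then have "parts_above j u = 0"
          using Cons.prems(2) by (intro parts_above_eq_0) (auto simp: Cons)
        then show ?thesis by simp
      qed
    qed
    have "power_sum_positive n (?F v - ?F u)"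
      using Cons.prems tail by (intro Cons.IH) (auto simp: Cons)
    moreover have "?F (a # v) - ?F w =
        (shifted_factor n a - shifted_factor n b) * ?F v + shifted_factor n b * (?F v - ?F u)"
      by (simp add: Cons algebra_simps)
    ultimately show ?thesis
      using pos head Cons.prems(3,4) assms(1)
      by (auto intro!: power_sum_positive_add power_sum_positive_mult_shifted_factor_diff
          power_sum_positive_mult_shifted_factor simp: Cons
          simp del: list.map prod_list.Cons prod_list.Nil)
  qed
qed

section \<open>Detecting the number of large parts\<close>

lemma of_rat_in_nonneg_Reals: "c \<ge> 0 \<Longrightarrow> (of_rat c :: complex) \<in> \<real>\<^sub>\<ge>\<^sub>0"
proof -
  assume "c \<ge> 0"
  have "(of_rat c :: complex) = of_real (of_rat c)"
    by (cases c) (simp add: of_rat_rat)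
  then show ?thesis
    using \<open>c \<ge> 0\<close> by simp
qed

lemma eval_at_nonneg:
  assumes "power_sum_positive n f" "\<forall>k\<in>{1..n}. power_sum n k x \<in> \<real>\<^sub>\<ge>\<^sub>0"
  shows "eval_at x f \<in> \<real>\<^sub>\<ge>\<^sub>0"
proof -
  obtain c A where A: "A \<subseteq> partitions n" "\<forall>\<nu>\<in>A. c \<nu> \<ge> 0"
    and f: "f = (\<Sum>\<nu>\<in>A. const (c \<nu>) * power_sum_part n (conjugate \<nu>) var)"
    using assms(1) unfolding power_sum_positive_iff by blast
  have part: "power_sum_part n (conjugate \<nu>) x \<in> \<real>\<^sub>\<ge>\<^sub>0" if "\<nu> \<in> A" for \<nu>
  proof -
    have "(\<Prod>k\<leftarrow>w. power_sum n k x) \<in> \<real>\<^sub>\<ge>\<^sub>0" if "\<forall>k\<in>set w. k \<in> {1..n}" for w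
      using that assms(2) by (induction w) auto
    moreover have "k \<le> n" if "k \<in> set (conjugate \<nu>)" for k
      using conjugate_parts_le[OF that] A(1) \<open>\<nu> \<in> A\<close> by (auto simp: partitions_def)
    ultimately show ?thesis
      by (auto simp: power_sum_part_def)
  qed
  have sum: "sum g A \<in> \<real>\<^sub>\<ge>\<^sub>0" if "\<And>i. i \<in> A \<Longrightarrow> g i \<in> \<real>\<^sub>\<ge>\<^sub>0" for g :: "nat list \<Rightarrow> complex"
    using that by (induction A rule: infinite_finite_induct) auto
  show ?thesis
    unfolding f using A(2) part by (auto intro!: sum nonneg_Reals_mult_I of_rat_in_nonneg_Reals)
qed

lemma eval_at_shifted_factor:
  assumes "n \<ge> 1" "1 \<le> m" "k \<le> n"
    and x: "\<forall>j\<in>{1..n}. power_sum n j x = (if j = m then of_nat n * of_real T else 0)"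
  shows "eval_at x (shifted_factor n k) = of_real (1 + of_nat (k choose m) * T)"
proof -
  have "eval_at x (shifted_factor n k) =
      (\<Sum>j\<le>k. of_rat (of_nat (k choose j) / of_nat n) * power_sum n j x)"
    by (simp add: shifted_factor_def)
  also have "{..k} = insert 0 {1..k}" by auto
  also have "(\<Sum>j\<in>insert 0 {1..k}. of_rat (of_nat (k choose j) / of_nat n) * power_sum n j x) =
      1 + (\<Sum>j\<in>{1..k}. of_rat (of_nat (k choose j) / of_nat n) * power_sum n j x)"
    using assms(1) by (simp add: power_sum_0 of_rat_divide)
  also have "(\<Sum>j\<in>{1..k}. of_rat (of_nat (k choose j) / of_nat n) * power_sum n j x) =
      (\<Sum>j\<in>{1..k}. if j = m then of_nat (k choose m) * of_real T else 0)"
    using assms by (intro sum.cong) (auto simp: of_rat_divide)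
  also have "\<dots> = of_nat (k choose m) * of_real T"
    using assms(2) by (cases "m \<le> k") auto
  finally show ?thesis by simp
qed

lemma power_le_prod_binomial_factors:
  fixes T :: real
  assumes "T \<ge> 0"
  shows "T ^ parts_above j w \<le> (\<Prod>k\<leftarrow>w. 1 + of_nat (k choose Suc j) * T)"
proof (induction w)
  case (Cons k w)
  have "(if j < k then T else 1) \<le> 1 + of_nat (k choose Suc j) * T"
  proof (cases "j < k")
    case True
    then have "1 \<le> k choose Suc j" by (simp add: Suc_leI)
    then have "1 * T \<le> of_nat (k choose Suc j) * T"
      using assms by (intro mult_right_mono) simp_all
    then show ?thesis using True by simp
  qed (use assms in simp)
  then have "(if j < k then T else 1) * T ^ parts_above j w \<le>
      (1 + of_nat (k choose Suc j) * T) * (\<Prod>k\<leftarrow>w. 1 + of_nat (k choose Suc j) * T)"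
    using assms Cons by (intro mult_mono) auto
  then show ?case by (simp split: if_splits)
qed simp

lemma prod_binomial_factors_le:
  fixes T :: real
  assumes "T \<ge> 1"
  shows "(\<Prod>k\<leftarrow>v. 1 + of_nat (k choose Suc j) * T) \<le>
    (\<Prod>k\<leftarrow>v. 1 + of_nat (k choose Suc j)) * T ^ parts_above j v"
proof (induction v)
  case (Cons k v)
  have nonneg: "0 \<le> (\<Prod>k\<leftarrow>v. 1 + of_nat (k choose Suc j) * T)"
    using assms by (intro prod_list_nonneg) auto
  have "1 + of_nat (k choose Suc j) * T \<le>
      (1 + of_nat (k choose Suc j)) * (if j < k then T else 1)"
    using assms by (simp add: algebra_simps binomial_eq_0)
  then have "(1 + of_nat (k choose Suc j) * T) * (\<Prod>k\<leftarrow>v. 1 + of_nat (k choose Suc j) * T) \<le>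
      ((1 + of_nat (k choose Suc j)) * (if j < k then T else 1)) *
      ((\<Prod>k\<leftarrow>v. 1 + of_nat (k choose Suc j)) * T ^ parts_above j v)"
    using assms Cons nonneg by (intro mult_mono) auto
  then show ?case by (simp add: mult_ac split: if_splits)
qed simp

text \<open>At a point with \<open>p\<^bsub>j+1\<^esub> = n T\<close> and the other power sums zero, the two products lie
  between constant multiples of powers of \<open>T\<close> whose exponents are the two counts. A larger
  exponent on the side of \<open>w\<close> is refuted by a single value \<open>T\<close>, one more than the constant
  \<open>M\<close> of the upper bound.\<close>

lemma parts_above_le_of_power_sum_positive:
  assumes "n \<ge> 1" "\<forall>a\<in>set v. a \<le> n" "\<forall>a\<in>set w. a \<le> n"
    and pos: "power_sum_positive n
      ((\<Prod>k\<leftarrow>v. shifted_factor n k) - (\<Prod>k\<leftarrow>w. shifted_factor n k))"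
  shows "parts_above j w \<le> parts_above j v"
proof (cases "j < n")
  case False
  then show ?thesis
    using assms(3) by (subst parts_above_eq_0) auto
next
  case True
  let ?B = "\<lambda>v T. \<Prod>k\<leftarrow>v. 1 + of_nat (k choose Suc j) * T :: real"
  have compare: "?B w T \<le> ?B v T" if "T \<ge> 0" for T
  proof -
    obtain x :: "nat \<Rightarrow> complex" where x: "\<forall>k\<in>{1..n}. power_sum n k x =
        (if k = Suc j then of_nat n * of_real T else 0)"
      using ex_point_with_power_sums[of n "\<lambda>k. if k = Suc j then of_nat n * of_real T else 0"]
      by blast
    have eval: "eval_at x (\<Prod>k\<leftarrow>u. shifted_factor n k) = of_real (?B u T)"
      if "\<forall>a\<in>set u. a \<le> n" for u
      using that eval_at_shifted_factor[OF assms(1) _ _ x] by (induction u) simp_all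
    have "\<forall>k\<in>{1..n}. power_sum n k x \<in> \<real>\<^sub>\<ge>\<^sub>0"
      using x that by auto
    from eval_at_nonneg[OF pos this] have "of_real (?B v T - ?B w T) \<in> (\<real>\<^sub>\<ge>\<^sub>0 :: complex set)"
      using eval assms(2,3) by (simp del: eval_at_prod_list)
    then show ?thesis unfolding nonneg_Reals_of_real_iff by simp
  qed
  define M :: real where "M = (\<Prod>k\<leftarrow>v. 1 + of_nat (k choose Suc j))"
  have "1 \<le> M" unfolding M_def
  proof (induction v)
    case (Cons k v)
    then show ?case
      by (simp add: mult_ge1_I)
  qed simp
  define T where "T = M + 1"
  have T: "T > 1" using \<open>1 \<le> M\<close> by (simp add: T_def)
  show ?thesis
  proof (rule ccontr)
    assume "\<not> parts_above j w \<le> parts_above j v"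
    then have "T * T ^ parts_above j v \<le> T ^ parts_above j w"
      using T power_increasing[of "Suc (parts_above j v)" "parts_above j w" T] by simp
    also have "\<dots> \<le> ?B w T"
      using T by (intro power_le_prod_binomial_factors) simp
    also have "\<dots> \<le> ?B v T"
      using T by (intro compare) simp
    also have "\<dots> \<le> M * T ^ parts_above j v"
      unfolding M_def using T by (intro prod_binomial_factors_le) simp
    finally show False
      using T by (simp add: T_def)
  qed
qed

section \<open>Positivity and containment\<close>

lemma power_sum_positive_shifted_ratio_diff_iff:
  assumes "n \<ge> 1" "sorted_wrt (\<ge>) v" "sorted_wrt (\<ge>) w"
    and "\<forall>a\<in>set v. a \<le> n" "\<forall>a\<in>set w. a \<le> n"
  shows "power_sum_positive n (shifted_ratio n v - shifted_ratio n w) \<longleftrightarrow>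
    (\<forall>j. parts_above j w \<le> parts_above j v)"
  unfolding shifted_ratio_eq_prod_list[OF assms(1)]
  using power_sum_positive_shifted_factors_diff[OF assms]
    parts_above_le_of_power_sum_positive[OF assms(1,4,5)] by blast

theorem theorem6p3:
  fixes n :: nat and lam mu :: "nat list"
  assumes "n \<ge> 1" and "lam \<in> partitions n" and "mu \<in> partitions n"
  shows "((\<forall>k \<in> set lam \<union> set mu. k \<le> n) \<longrightarrow>
            (contains lam mu \<longleftrightarrow>
               power_sum_positive n (shifted_ratio n lam - shifted_ratio n mu)))
       \<and> (contains lam mu \<longleftrightarrow>
            power_sum_positive n (shifted_ratio n (conjugate lam) - shifted_ratio n (conjugate mu)))"
proof -
  have part: "sorted_wrt (\<ge>) lam" "sorted_wrt (\<ge>) mu" "length lam = n" "length mu = n"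
    using assms(2,3) by (simp_all add: partitions_def)
  have "contains lam mu \<longleftrightarrow> power_sum_positive n (shifted_ratio n lam - shifted_ratio n mu)"
    if "\<forall>k \<in> set lam \<union> set mu. k \<le> n"
    using part that assms(1)
    by (simp add: contains_iff_parts_above power_sum_positive_shifted_ratio_diff_iff)
  moreover have "\<forall>a\<in>set (conjugate lam). a \<le> n" "\<forall>a\<in>set (conjugate mu). a \<le> n"
    using conjugate_parts_le[of _ lam] conjugate_parts_le[of _ mu] part(3,4) by auto
  then have "contains lam mu \<longleftrightarrow>
      power_sum_positive n (shifted_ratio n (conjugate lam) - shifted_ratio n (conjugate mu))"
    using part assms(1)
    by (simp add: contains_iff_parts_above_conjugate
        power_sum_positive_shifted_ratio_diff_iff sorted_conjugate)
  ultimately show ?thesis by blast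
qed

end
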